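(* Suppose $d \le n/2$ and $\nu_2 n \le k$. Suppose that with probability at least $1-\Delta$ when $Y,Y' \sim G(n,d/n)$ independently, the family $\mathcal{F}(Y,Y')$ has the $(k,\nu_1,\nu_2)$-overlap gap property, and $F(\cdot\,;Y)$ and $F(\cdot\,;Y')$ are $\nu_1$-separated above $k$. If \[ \Delta + 3\delta(m+1) < \exp\left(-\frac{96 \gamma D k \log(n/d)}{(\nu_2 - \nu_1)^2 n}\right) \] then for any $\eta \le \frac{1}{4}(\nu_2 - \nu_1)^2$, there is no random degree-$D$ polynomial that $(k,\delta,\gamma,\eta)$-optimizes the maximum independent set problem $\max_{S \in \mathcal{I}(Y)} |S|$ for $Y \sim G(n,d/n)$.
   Context: Setting: a graph on vertex set $[n]$ is encoded by its adjacency vector $Y \in \{0,1\}^m$ with $m = \binom{n}{2}$ (edges indexed in a fixed arbitrary order); $G(n,d/n)$ denotes the Erdős–Rényi graph where each edge is present independently with probability $d/n$. $\mathcal{I}(Y)$ denotes the set of independent sets of $Y$. For $x \in \{0,1\}^n$ let $S(x) = \{i : x_i = 1\}$, and define $F(x;Y) = |S(x)| \cdot \mathbf{1}\{S(x) \in \mathcal{I}(Y)\}$. The overlap is $R(x_1,x_2) = \frac{1}{n}|\langle x_1,x_2\rangle|$. For $Y,Y' \in \{0,1\}^m$, the path from $Y$ to $Y'$ is $Y = Z_0 \to Z_1 \to \cdots \to Z_m = Y'$ where $(Z_i)_j = Y_j$ for $j > i$ and $(Z_i)_j = Y'_j$ otherwise. The family $\mathcal{F}(Y,Y') = \{F(\cdot\,;Z)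 : Z \text{ on the path from } Y \text{ to } Y'\}$. A family of functions with common domain $\{0,1\}^n$ has the $(\mu,\nu_1,\nu_2)$-overlap gap property (for $R$) if for every $f_1,f_2$ in the family and every $x_1,x_2$ with $f_1(x_1) \ge \mu$, $f_2(x_2) \ge \mu$, we have $R(x_1,x_2) \in [0,\nu_1] \cup [\nu_2,1]$. Two functions $f,g$ are $\nu$-separated above $\mu$ if $f(x) \ge \mu$ and $g(y) \ge \mu$ imply $R(x,y) \le \nu$. A random polynomial $f: \{0,1\}^m \to \mathbb{R}^n$ is a function $f(Y,\omega)$, with $\omega$ drawn from a probability space independent of $Y$, such that for each $\omega$ every coordinate $f_i(\cdot,\omega)$ is a polynomial of degree at most $D$. Rounding: let $A = \{i : f_i(Y,\omega) \ge 1\}$, $\tilde A = \{i \in A : i \text{ has no neighbors in } A \text{ in } Y\}$, $B = \{i : f_i(Y,\omega) \in (1/2,1)\}$; set $V^\eta_f(Y,\omega) = \tilde A$ if $|A \setminus \tilde A| + |B| \le \eta n$, and $V^\eta_f(Y,\omega) = \emptyset$ otherwise. For $k \in \mathbb{N}$, $\delta \in [0,1]$, $\gamma \ge 1$, $\eta > 0$, $f$ is said to $(k,\delta,\gamma,\eta)$-optimize the maximum independent set problem if $\mathbb{E}_{Y,\omega}\|f(Y,\omega)\|_2^2 \le \gamma k$ and, with probability at least $1-\delta$ over $Y \sim G(n,d/n)$ and $\omega$, $|V^\eta_f(Y,\omega)| \ge k$. *)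

theory Defs
  imports "HOL-Probability.Probability" "HOL-Library.Poly_Mapping"
begin

text \<open>
  Vectors in \<open>{0,1}\<^sup>N\<close> are functions on \<open>nat\<close> with values in \<open>{0,1}\<close> at the coordinates
  \<open>1, \<dots>, N\<close>, extended by \<open>0\<close> to all other arguments (the convention of \<open>Pi_pmf\<close>).
\<close>

definition cube :: "nat \<Rightarrow> (nat \<Rightarrow> real) set" where
  "cube N = PiE_dflt {1..N} 0 (\<lambda>_. {0, 1})"

definition edge_order :: "nat \<Rightarrow> (nat \<Rightarrow> nat set) \<Rightarrow> bool" where
  "edge_order n e \<longleftrightarrow>
     bij_betw e {1..n choose 2} {{u, v} | u v. u \<in> {1..n} \<and> v \<in> {1..n} \<and> u \<noteq> v}"

definition adjacent :: "nat \<Rightarrow> (nat \<Rightarrow> nat set) \<Rightarrow> (nat \<Rightarrow> real) \<Rightarrow> nat \<Rightarrow> nat \<Rightarrow> bool" where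
  "adjacent n e Y u v \<longleftrightarrow> (\<exists>j\<in>{1..n choose 2}. e j = {u, v} \<and> Y j = 1)"

definition indep_sets_of :: "nat \<Rightarrow> (nat \<Rightarrow> nat set) \<Rightarrow> (nat \<Rightarrow> real) \<Rightarrow> nat set set" where
  "indep_sets_of n e Y = {S. S \<subseteq> {1..n} \<and> (\<forall>u\<in>S. \<forall>v\<in>S. \<not> adjacent n e Y u v)}"

text \<open>The law of the adjacency vector of the random graph \<open>G(n,p)\<close>.\<close>

definition gnp :: "nat \<Rightarrow> real \<Rightarrow> (nat \<Rightarrow> real) pmf" where
  "gnp n p = Pi_pmf {1..n choose 2} 0 (\<lambda>_. map_pmf of_bool (bernoulli_pmf p))"

definition support_set :: "nat \<Rightarrow> (nat \<Rightarrow> real) \<Rightarrow> nat set" where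
  "support_set n x = {i \<in> {1..n}. x i = 1}"

definition objective :: "nat \<Rightarrow> (nat \<Rightarrow> nat set) \<Rightarrow> (nat \<Rightarrow> real) \<Rightarrow> (nat \<Rightarrow> real) \<Rightarrow> real" where
  "objective n e Y x =
     real (card (support_set n x)) * of_bool (support_set n x \<in> indep_sets_of n e Y)"

definition overlap :: "nat \<Rightarrow> (nat \<Rightarrow> real) \<Rightarrow> (nat \<Rightarrow> real) \<Rightarrow> real" where
  "overlap n x y = \<bar>\<Sum>i\<in>{1..n}. x i * y i\<bar> / real n"

definition path_vertex :: "nat \<Rightarrow> (nat \<Rightarrow> real) \<Rightarrow> (nat \<Rightarrow> real) \<Rightarrow> nat \<Rightarrow> real" where
  "path_vertex i Y Y' = (\<lambda>j. if j > i then Y j else Y' j)"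

definition path_family ::
    "nat \<Rightarrow> (nat \<Rightarrow> nat set) \<Rightarrow> (nat \<Rightarrow> real) \<Rightarrow> (nat \<Rightarrow> real) \<Rightarrow> ((nat \<Rightarrow> real) \<Rightarrow> real) set" where
  "path_family n e Y Y' = {objective n e (path_vertex i Y Y') | i. i \<in> {0..n choose 2}}"

definition overlap_gap ::
    "nat \<Rightarrow> ((nat \<Rightarrow> real) \<Rightarrow> real) set \<Rightarrow> real \<Rightarrow> real \<Rightarrow> real \<Rightarrow> bool" where
  "overlap_gap n \<F> \<mu> \<nu>1 \<nu>2 \<longleftrightarrow>
     (\<forall>f1\<in>\<F>. \<forall>f2\<in>\<F>. \<forall>x1\<in>cube n. \<forall>x2\<in>cube n.
        f1 x1 \<ge> \<mu> \<longrightarrow> f2 x2 \<ge> \<mu> \<longrightarrow> overlap n x1 x2 \<in> {0..\<nu>1} \<union> {\<nu>2..1})"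

definition separated_above ::
    "nat \<Rightarrow> ((nat \<Rightarrow> real) \<Rightarrow> real) \<Rightarrow> ((nat \<Rightarrow> real) \<Rightarrow> real) \<Rightarrow> real \<Rightarrow> real \<Rightarrow> bool" where
  "separated_above n f g \<nu> \<mu> \<longleftrightarrow>
     (\<forall>x\<in>cube n. \<forall>y\<in>cube n. f x \<ge> \<mu> \<longrightarrow> g y \<ge> \<mu> \<longrightarrow> overlap n x y \<le> \<nu>)"

text \<open>
  A multivariate polynomial is a finitely supported map from monomials (themselves finitely
  supported exponent vectors) to coefficients.
\<close>

definition eval_mpoly :: "((nat \<Rightarrow>\<^sub>0 nat) \<Rightarrow>\<^sub>0 real) \<Rightarrow> (nat \<Rightarrow> real) \<Rightarrow> real" where
  "eval_mpoly q x =
     (\<Sum>\<alpha>\<in>Poly_Mapping.keys q. Poly_Mapping.lookup q \<alpha> *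
        (\<Prod>j\<in>Poly_Mapping.keys \<alpha>. x j ^ Poly_Mapping.lookup \<alpha> j))"

definition mpolys_deg_le :: "nat \<Rightarrow> nat \<Rightarrow> ((nat \<Rightarrow>\<^sub>0 nat) \<Rightarrow>\<^sub>0 real) set" where
  "mpolys_deg_le N D =
     {q. \<forall>\<alpha>\<in>Poly_Mapping.keys q. Poly_Mapping.keys \<alpha> \<subseteq> {1..N} \<and>
           (\<Sum>j\<in>Poly_Mapping.keys \<alpha>. Poly_Mapping.lookup \<alpha> j) \<le> D}"

text \<open>
  A random polynomial \<open>{0,1}\<^sup>m \<rightarrow> \<real>\<^sup>n\<close> with \<open>m = n choose 2\<close>; \<open>f Y \<omega> i\<close> is the
  \<open>i\<close>-th coordinate of \<open>f(Y,\<omega>)\<close>.  Only the values at \<open>Y \<in> {0,1}\<^sup>m\<close> and \<open>i \<in> {1..n}\<close> matter.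
  Measurability in \<open>\<omega>\<close> is part of \<open>f\<close> being a random function.
\<close>

definition random_polynomial ::
    "nat \<Rightarrow> nat \<Rightarrow> 'w measure \<Rightarrow> ((nat \<Rightarrow> real) \<Rightarrow> 'w \<Rightarrow> nat \<Rightarrow> real) \<Rightarrow> bool" where
  "random_polynomial n D \<Omega> f \<longleftrightarrow>
     prob_space \<Omega> \<and>
     (\<forall>Y\<in>cube (n choose 2). \<forall>i\<in>{1..n}. (\<lambda>\<omega>. f Y \<omega> i) \<in> borel_measurable \<Omega>) \<and>
     (\<forall>\<omega>\<in>space \<Omega>. \<forall>i\<in>{1..n}. \<exists>q\<in>mpolys_deg_le (n choose 2) D.
        \<forall>Y\<in>cube (n choose 2). f Y \<omega> i = eval_mpoly q Y)"

definition rounded ::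
    "nat \<Rightarrow> (nat \<Rightarrow> nat set) \<Rightarrow> real \<Rightarrow> ((nat \<Rightarrow> real) \<Rightarrow> 'w \<Rightarrow> nat \<Rightarrow> real) \<Rightarrow>
     (nat \<Rightarrow> real) \<Rightarrow> 'w \<Rightarrow> nat set" where
  "rounded n e \<eta> f Y \<omega> =
     (let A = {i \<in> {1..n}. f Y \<omega> i \<ge> 1};
          A' = {i \<in> A. \<forall>v\<in>A. \<not> adjacent n e Y i v};
          B = {i \<in> {1..n}. 1/2 < f Y \<omega> i \<and> f Y \<omega> i < 1}
      in if real (card (A - A')) + real (card B) \<le> \<eta> * real n then A' else {})"

text \<open>
  The second moment is a nonnegative integral, so the bound also asserts its finiteness.  The
  event is intersected with \<open>{0,1}\<^sup>m\<close>, the support of \<open>Y\<close>, to make it measurable no matter what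
  \<open>f\<close> does outside.
\<close>

definition optimizes ::
    "nat \<Rightarrow> (nat \<Rightarrow> nat set) \<Rightarrow> real \<Rightarrow> 'w measure \<Rightarrow> ((nat \<Rightarrow> real) \<Rightarrow> 'w \<Rightarrow> nat \<Rightarrow> real) \<Rightarrow>
     nat \<Rightarrow> real \<Rightarrow> real \<Rightarrow> real \<Rightarrow> bool" where
  "optimizes n e d \<Omega> f k \<delta> \<gamma> \<eta> \<longleftrightarrow>
     (let M = measure_pmf (gnp n (d / real n)) \<Otimes>\<^sub>M \<Omega> in
       (\<integral>\<^sup>+ (Y, \<omega>). ennreal (\<Sum>i\<in>{1..n}. (f Y \<omega> i)\<^sup>2) \<partial>M) \<le> ennreal (\<gamma> * real k) \<and>
       measure M {(Y, \<omega>). Y \<in> cube (n choose 2) \<and> \<omega> \<in> space \<Omega> \<and>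
                          card (rounded n e \<eta> f Y \<omega>) \<ge> k} \<ge> 1 - \<delta>)"

end

theory Submission
  imports Defs
begin

text \<open>
  Fix a seed \<open>\<omega>\<close> for which second moment and failure probability of \<open>f\<close> are at most three times
  their means.  Call an edge of the cube bad if \<open>f\<close> jumps across it by more than
  \<open>T = (\<nu>\<^sub>2 - \<nu>\<^sub>1)\<^sup>2 n / 8\<close> in squared norm.  As \<open>f\<close> has degree \<open>D\<close>, its total influence is at most
  \<open>D\<close> times its second moment, so bad edges are rare, and the path from \<open>Y\<close> to \<open>Y'\<close> avoids them with
  probability at least the right-hand side of the hypothesis on \<open>\<Delta>\<close>.  That hypothesis therefore
  leaves room for a path which avoids bad edges, has the overlap gap property and on which the
  rounding succeeds at every vertex.  Along it the overlap with the first independent set falls from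
  \<open>\<ge> \<nu>\<^sub>2\<close> to \<open>\<le> \<nu>\<^sub>1\<close>, while the steps of \<open>f\<close> are too short to cross the gap.
\<close>

section \<open>Biased product measure and influences\<close>

abbreviation biased :: "real \<Rightarrow> nat set \<Rightarrow> (nat \<Rightarrow> real) pmf" where
  "biased p A \<equiv> Pi_pmf A 0 (\<lambda>_. map_pmf of_bool (bernoulli_pmf p))"

abbreviation mean :: "real \<Rightarrow> nat set \<Rightarrow> ((nat \<Rightarrow> real) \<Rightarrow> real) \<Rightarrow> real" where
  "mean p A g \<equiv> measure_pmf.expectation (biased p A) g"

lemma finite_set_biased [intro, simp]: "finite A \<Longrightarrow> finite (set_pmf (biased p A))"
  by (simp add: set_Pi_pmf finite_PiE_dflt)

lemma integrable_biased [intro, simp]: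
  fixes g :: "(nat \<Rightarrow> real) \<Rightarrow> real"
  shows "finite A \<Longrightarrow> integrable (measure_pmf (biased p A)) g"
  by (simp add: integrable_measure_pmf_finite)

lemma set_biased_subset:
  assumes "finite A" "z \<in> set_pmf (biased p A)"
  shows "z \<in> PiE_dflt A 0 (\<lambda>_. {0, 1})"
  using assms by (fastforce simp: set_Pi_pmf PiE_dflt_def)

text \<open>Fubini; finite supports make every real function integrable, so \<open>g\<close> is
  arbitrary.\<close>

lemma expectation_pair_pmf_finite:
  fixes g :: "'a \<times> 'b \<Rightarrow> real"
  assumes "finite (set_pmf P)" "finite (set_pmf Q)"
  shows "measure_pmf.expectation (pair_pmf P Q) g =
         measure_pmf.expectation P (\<lambda>x. measure_pmf.expectation Q (\<lambda>y. g (x, y)))"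
proof -
  have "measure_pmf.expectation (Q \<bind> (\<lambda>y. return_pmf (x, y))) g =
        measure_pmf.expectation Q (\<lambda>y. g (x, y))" for x
    by (subst pmf_expectation_bind[of "set_pmf Q"])
       (use assms in \<open>auto simp: integral_measure_pmf[of "set_pmf Q"]\<close>)
  then show ?thesis
    unfolding pair_pmf_def
    by (subst pmf_expectation_bind[of "set_pmf P"])
       (use assms in \<open>auto simp: integral_measure_pmf[of "set_pmf P"]\<close>)
qed

text \<open>Squarefree form of a polynomial on the cube, with one coefficient per set of variables:
  degree at most \<open>D\<close> becomes \<open>c S = 0\<close> whenever
  \<open>D < card S\<close>.\<close>

definition multilin :: "(nat set \<Rightarrow> real) \<Rightarrow> nat set \<Rightarrow> (nat \<Rightarrow> real) \<Rightarrow> real" where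
  "multilin c A z = (\<Sum>S\<in>Pow A. c S * (\<Prod>j\<in>S. z j))"

lemma multilin_upd: "a \<notin> A \<Longrightarrow> multilin c A (z(a := b)) = multilin c A z"
  unfolding multilin_def by (intro sum.cong refl arg_cong2[of _ _ _ _ "(*)"] prod.cong) auto

text \<open>The sets that contain \<open>a\<close> are collected into the factor of
  \<open>z a\<close>, which is the discrete derivative in direction \<open>a\<close>.\<close>

lemma multilin_insert:
  assumes "finite A" "a \<notin> A"
  shows "multilin c (insert a A) z = multilin c A z + z a * multilin (\<lambda>S. c (insert a S)) A z"
proof -
  have inj: "inj_on (insert a) (Pow A)"
    using assms by (auto simp: inj_on_def)
  have "multilin c (insert a A) z =
      multilin c A z + (\<Sum>S\<in>Pow A. c (insert a S) * (\<Prod>j\<in>insert a S. z j))"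
    unfolding multilin_def Pow_insert
    by (subst sum.union_disjoint) (use assms inj in \<open>auto simp: sum.reindex\<close>)
  also have "(\<Sum>S\<in>Pow A. c (insert a S) * (\<Prod>j\<in>insert a S. z j)) =
      z a * multilin (\<lambda>S. c (insert a S)) A z"
    unfolding multilin_def sum_distrib_left
  proof (intro sum.cong refl)
    fix S assume "S \<in> Pow A"
    then have "finite S" "a \<notin> S" using assms finite_subset by auto
    then show "c (insert a S) * (\<Prod>j\<in>insert a S. z j) = z a * (c (insert a S) * (\<Prod>j\<in>S. z j))"
      by simp
  qed
  finally show ?thesis .
qed

lemma multilin_add: "multilin (\<lambda>S. c S + t * c' S) A z = multilin c A z + t * multilin c' A z"
  by (simp add: multilin_def sum.distrib sum_distrib_left algebra_simps)

context
  fixes p :: real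
  assumes p: "0 < p" "p < 1"
begin

section \<open>Averages over a single coordinate\<close>

lemma mean_insert:
  assumes "finite A" "a \<notin> A"
  shows "mean p (insert a A) g = mean p A (\<lambda>z. p * g (z(a := 1)) + (1 - p) * g (z(a := 0)))"
proof -
  have "mean p (insert a A) g =
      measure_pmf.expectation (pair_pmf (map_pmf of_bool (bernoulli_pmf p)) (biased p A))
        (\<lambda>(y, z). g (z(a := y)))"
    using assms by (simp add: Pi_pmf_insert case_prod_unfold)
  also have "\<dots> = p * mean p A (\<lambda>z. g (z(a := 1))) + (1 - p) * mean p A (\<lambda>z. g (z(a := 0)))"
    using assms p by (subst expectation_pair_pmf_finite) (auto simp: mult.commute)
  also have "\<dots> = mean p A (\<lambda>z. p * g (z(a := 1)) + (1 - p) * g (z(a := 0)))"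
    using assms by simp
  finally show ?thesis .
qed

text \<open>Coordinate \<open>a\<close> is independent of the others, so redrawing it preserves the
  law. This stationarity is applied at every step of the random path.\<close>

lemma mean_resample:
  assumes "finite A" "a \<in> A"
  shows "mean p A (\<lambda>z. p * g (z(a := 1)) + (1 - p) * g (z(a := 0))) = mean p A g"
proof -
  have A: "A = insert a (A - {a})" "finite (A - {a})" "a \<notin> A - {a}"
    using assms by auto
  show ?thesis
    by (subst (1 2) A(1), subst (1 2) mean_insert[OF A(2,3)]) (simp add: algebra_simps)
qed

text \<open>Writing \<open>F = g + z\<^sub>a h = (g + p h) + (z\<^sub>a - p) h\<close> splits \<open>F\<close> orthogonally into parts built from
  \<open>g + p h\<close> (of degree \<open>D\<close>) and \<open>h\<close> (of degree \<open>D - 1\<close>).\<close>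

lemma total_influence_le:
  assumes "finite A" "\<And>S. S \<subseteq> A \<Longrightarrow> D < card S \<Longrightarrow> c S = 0"
  shows "p * (1 - p) * (\<Sum>j\<in>A. mean p A (\<lambda>z. (multilin c A (z(j := 1)) - multilin c A (z(j := 0)))\<^sup>2))
           \<le> real D * mean p A (\<lambda>z. (multilin c A z)\<^sup>2)"
  using assms
proof (induction A arbitrary: c D rule: finite_induct)
  case empty
  then show ?case by simp
next
  case (insert a A)
  define q where "q = p * (1 - p)"
  define I where "I c = q * (\<Sum>j\<in>A. mean p A (\<lambda>z. (multilin c A (z(j := 1)) - multilin c A (z(j := 0)))\<^sup>2))"
    for c :: "nat set \<Rightarrow> real"
  define E where "E c = mean p A (\<lambda>z. (multilin c A z)\<^sup>2)" for c :: "nat set \<Rightarrow> real"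
  \<comment> \<open>\<open>c1\<close> holds the coefficients of \<open>h\<close> and
    \<open>c0\<close> those of \<open>g + p h\<close>, in the notation of the splitting
    above.\<close>
  define c1 where "c1 = (\<lambda>S. c (insert a S))"
  define c0 where "c0 = (\<lambda>S. c S + p * c1 S)"
  have q: "0 \<le> q" using p by (simp add: q_def)
  note simps = multilin_insert[OF insert.hyps, of c, folded c1_def]
  \<comment> \<open>For a \<open>p\<close>-biased bit \<open>b\<close>, the second moment of
    \<open>x + b * y\<close> is its squared mean plus its variance. This is applied to the
    polynomial and to its discrete derivatives.\<close>
  have mean_sq: "p * (x + y)\<^sup>2 + (1 - p) * x\<^sup>2 = (x + p * y)\<^sup>2 + q * y\<^sup>2" for x y
    by (simp add: q_def power2_eq_square algebra_simps)
  have E_eq: "mean p (insert a A) (\<lambda>z. (multilin c (insert a A) z)\<^sup>2) = E c0 + q * E c1"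
    using insert.hyps
    by (simp add: mean_insert simps multilin_upd mean_sq E_def c0_def multilin_add)
  have Ia: "mean p (insert a A) (\<lambda>z. (multilin c (insert a A) (z(a := 1)) -
      multilin c (insert a A) (z(a := 0)))\<^sup>2) = E c1"
    using insert.hyps by (simp add: mean_insert simps multilin_upd E_def algebra_simps)
  have Ij: "mean p (insert a A) (\<lambda>z. (multilin c (insert a A) (z(j := 1)) -
        multilin c (insert a A) (z(j := 0)))\<^sup>2) =
      mean p A (\<lambda>z. (multilin c0 A (z(j := 1)) - multilin c0 A (z(j := 0)))\<^sup>2) +
      q * mean p A (\<lambda>z. (multilin c1 A (z(j := 1)) - multilin c1 A (z(j := 0)))\<^sup>2)"
    if "j \<in> A" for j
  proof -
    have ja: "j \<noteq> a" using that insert.hyps by auto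
    have "multilin c (insert a A) ((z(a := b))(j := b')) =
        multilin c A (z(j := b')) + b * multilin c1 A (z(j := b'))" for z :: "nat \<Rightarrow> real" and b b'
      using insert.hyps by (simp add: simps fun_upd_twist[OF ja[symmetric]] multilin_upd ja)
    then have "mean p (insert a A) (\<lambda>z. (multilin c (insert a A) (z(j := 1)) -
        multilin c (insert a A) (z(j := 0)))\<^sup>2) =
      mean p A (\<lambda>z. p * ((multilin c A (z(j := 1)) - multilin c A (z(j := 0))) +
           (multilin c1 A (z(j := 1)) - multilin c1 A (z(j := 0))))\<^sup>2 +
         (1 - p) * (multilin c A (z(j := 1)) - multilin c A (z(j := 0)))\<^sup>2)"
      using insert.hyps by (simp add: mean_insert algebra_simps)
    also have "\<dots> = mean p A (\<lambda>z. (multilin c0 A (z(j := 1)) - multilin c0 A (z(j := 0)))\<^sup>2 +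
        q * (multilin c1 A (z(j := 1)) - multilin c1 A (z(j := 0)))\<^sup>2)"
      unfolding mean_sq c0_def multilin_add by (simp add: algebra_simps)
    finally show ?thesis using insert.hyps by simp
  qed
  have I_eq: "q * (\<Sum>j\<in>insert a A. mean p (insert a A) (\<lambda>z. (multilin c (insert a A) (z(j := 1)) -
        multilin c (insert a A) (z(j := 0)))\<^sup>2)) = I c0 + q * I c1 + q * E c1"
    using insert.hyps
    by (simp add: Ia Ij I_def sum.distrib sum_distrib_left algebra_simps)
  have c0: "c0 S = 0" if "S \<subseteq> A" "D < card S" for S
  proof -
    have "finite S" "a \<notin> S" using that insert.hyps finite_subset by auto
    then show ?thesis using that insert.prems[of S] insert.prems[of "insert a S"]
      by (simp add: c0_def c1_def subset_insertI2)
  qed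
  have I0: "I c0 \<le> D * E c0"
    unfolding I_def E_def q_def by (rule insert.IH) (rule c0)
  \<comment> \<open>\<open>h\<close> has degree at most \<open>D - 1\<close>, which pays for the
    extra \<open>E c1\<close> coming from the influence of \<open>a\<close>; for
    \<open>D = 0\<close> the part \<open>h\<close> vanishes.\<close>
  have "I c1 + E c1 \<le> D * E c1"
  proof (cases D)
    case 0
    have "c1 S = 0" if "S \<subseteq> A" for S
    proof -
      have "finite (insert a S)" using that insert.hyps finite_subset by auto
      then show ?thesis using that insert.prems[of "insert a S"] 0
        by (auto simp: c1_def card_gt_0_iff)
    qed
    then have "multilin c1 A z = 0" for z
      unfolding multilin_def by (intro sum.neutral) auto
    then show ?thesis by (simp add: I_def E_def)
  next
    case (Suc D')
    have "c1 S = 0" if "S \<subseteq> A" "D' < card S" for S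
    proof -
      have "finite S" "a \<notin> S" using that insert.hyps finite_subset by auto
      then show ?thesis using that insert.prems[of "insert a S"] Suc
        by (simp add: c1_def subset_insertI2)
    qed
    then have "I c1 \<le> D' * E c1"
      unfolding I_def E_def q_def by (intro insert.IH)
    then show ?thesis by (simp add: Suc algebra_simps)
  qed
  then have "q * (I c1 + E c1) \<le> q * (D * E c1)"
    by (intro mult_left_mono q)
  with I0 show ?case
    unfolding q_def[symmetric] I_eq E_eq by (simp add: algebra_simps)
qed

end

lemma mean_cong:
  assumes "finite A" "\<And>z. z \<in> PiE_dflt A 0 (\<lambda>_. {0, 1}) \<Longrightarrow> f z = g z"
  shows "mean p A f = mean p A g"
  using assms set_biased_subset[OF assms(1)]
  by (intro integral_cong_AE) (auto simp: AE_measure_pmf_iff)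

lemma mean_mono:
  assumes "finite A" "\<And>z. z \<in> PiE_dflt A 0 (\<lambda>_. {0, 1}) \<Longrightarrow> f z \<le> g z"
  shows "mean p A f \<le> mean p A g"
  using assms set_biased_subset[OF assms(1)]
  by (intro integral_mono_AE) (auto simp: AE_measure_pmf_iff)

lemma exp_mean_ln_le:
  assumes "finite A" "\<And>z. 0 < g z"
  shows "exp (mean p A (\<lambda>z. ln (g z))) \<le> mean p A g"
proof -
  have "exp (mean p A (\<lambda>z. ln (g z))) \<le> mean p A (\<lambda>z. exp (ln (g z)))"
    using assms
    by (intro measure_pmf.jensens_inequality[where I = UNIV]) (auto simp: exp_convex)
  then show ?thesis using assms by simp
qed

section \<open>Random paths avoiding bad edges\<close>

text \<open>\<open>bad j z\<close> concerns the edge in direction \<open>j\<close> at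
  \<open>z\<close>. Step \<open>j\<close> starts at \<open>path_vertex (j - 1)\<close>; a bad edge
  there is harmless if the step keeps the bit.\<close>

definition avoids :: "(nat \<Rightarrow> (nat \<Rightarrow> real) \<Rightarrow> bool) \<Rightarrow> nat \<Rightarrow> (nat \<Rightarrow> real) \<Rightarrow> (nat \<Rightarrow> real) \<Rightarrow> bool" where
  "avoids bad i Y Y' \<longleftrightarrow> (\<forall>j\<in>{1..i}. bad j (path_vertex (j - 1) Y Y') \<longrightarrow> Y' j = Y j)"

lemma path_vertex_upd: "i < j \<Longrightarrow> path_vertex i Y (Y'(j := b)) = path_vertex i Y Y'"
  by (auto simp: path_vertex_def)

lemma path_vertex_Suc_upd:
  "path_vertex (Suc i) Y (Y'(Suc i := b)) = (path_vertex i Y Y')(Suc i := b)"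
  by (auto simp: path_vertex_def fun_eq_iff)

text \<open>Coordinate \<open>0\<close> is taken from \<open>Y'\<close> already at index
  \<open>0\<close>, so both vectors must carry the default value outside
  \<open>{1..m}\<close>.\<close>

lemma path_vertex_0:
  assumes "Y \<in> PiE_dflt {1..m} 0 B" "Y' \<in> PiE_dflt {1..m} 0 B"
  shows "path_vertex 0 Y Y' = Y"
  using assms by (auto simp: path_vertex_def fun_eq_iff PiE_dflt_def)

text \<open>Bit \<open>Suc i\<close> of \<open>Y'\<close> enters only the condition on the last
  step, so it can be averaged out with the earlier steps fixed.\<close>

lemma avoids_Suc_upd:
  "avoids bad (Suc i) Y (Y'(Suc i := b)) \<longleftrightarrow>
     avoids bad i Y Y' \<and> (bad (Suc i) (path_vertex i Y Y') \<longrightarrow> b = Y (Suc i))"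
proof -
  have "path_vertex (j - 1) Y (Y'(Suc i := b)) = path_vertex (j - 1) Y Y'" if "j \<le> Suc i" for j
    by (rule path_vertex_upd) (use that in auto)
  then show ?thesis
    unfolding avoids_def atLeastAtMostSuc_conv[of 1 i, simplified] by auto
qed

context
  fixes p :: real
  assumes p: "0 < p" "p < 1"
begin

text \<open>Each step replaces one bit by an independent copy with the same law. The induction runs
  over all test functions \<open>\<phi>\<close>, which absorb the averaging over the last
  bit.\<close>

lemma mean_path_vertex:
  assumes "i \<le> m"
  shows "mean p {1..m} (\<lambda>Y. mean p {1..m} (\<lambda>Y'. \<phi> (path_vertex i Y Y'))) = mean p {1..m} \<phi>"
  using assms
proof (induction i arbitrary: \<phi>)
  case 0
  have "mean p {1..m} (\<lambda>Y. mean p {1..m} (\<lambda>Y'. \<phi> (path_vertex 0 Y Y'))) =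
        mean p {1..m} (\<lambda>Y. mean p {1..m} (\<lambda>Y'. \<phi> Y))"
    by (intro mean_cong) (simp_all add: path_vertex_0)
  then show ?case by simp
next
  case (Suc i)
  have "mean p {1..m} (\<lambda>Y. mean p {1..m} (\<lambda>Y'. \<phi> (path_vertex (Suc i) Y Y'))) =
        mean p {1..m} (\<lambda>Y. mean p {1..m} (\<lambda>Y'. p * \<phi> ((path_vertex i Y Y')(Suc i := 1)) +
          (1 - p) * \<phi> ((path_vertex i Y Y')(Suc i := 0))))"
    using Suc.prems
    by (subst mean_resample[OF p, of _ "Suc i", symmetric]) (auto simp: path_vertex_Suc_upd)
  also have "\<dots> = mean p {1..m} (\<lambda>z. p * \<phi> (z(Suc i := 1)) + (1 - p) * \<phi> (z(Suc i := 0)))"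
    by (rule Suc.IH[of "\<lambda>z. p * \<phi> (z(Suc i := 1)) + (1 - p) * \<phi> (z(Suc i := 0))"])
       (use Suc.prems in auto)
  also have "\<dots> = mean p {1..m} \<phi>"
    by (rule mean_resample[OF p]) (use Suc.prems in auto)
  finally show ?case .
qed

text \<open>Concavity of \<open>ln\<close>, read off from convexity of \<open>exp\<close> at
  \<open>ln x\<close> and \<open>ln y\<close>.\<close>

lemma ln_mix_ge:
  assumes "0 < x" "0 < y"
  shows "p * ln x + (1 - p) * ln y \<le> ln (p * x + (1 - p) * y)"
proof -
  have "exp (p * ln x + (1 - p) * ln y) \<le> p * exp (ln x) + (1 - p) * exp (ln y)"
    using convex_onD[OF exp_convex, of "1 - p" "ln x" "ln y"] p by simp
  then have "exp (p * ln x + (1 - p) * ln y) \<le> p * x + (1 - p) * y"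
    using assms by simp
  moreover have "0 < p * x + (1 - p) * y"
    using assms p by (simp add: add_pos_pos)
  ultimately show ?thesis by (simp add: ln_ge_iff)
qed

text \<open>A walk that refuses to cross bad edges still has the product measure as its stationary
  law, so the expected number of its refusals is a sum of stationary probabilities.  On paths that
  cross no bad edge, the density of the unrestricted walk relative to this one is the product of the
  probabilities of the bits kept at the refusals; Jensen's inequality for \<open>exp\<close> turns this into a
  lower bound.  The test function \<open>\<phi>\<close> carries the induction over the steps.\<close>

lemma mean_avoids_ge:
  assumes bad: "\<And>j z b. bad j (z(j := b)) = bad j z"
    and "i \<le> m" and "\<And>z. 0 < \<phi> z"
  shows "exp (mean p {1..m} (\<lambda>z. ln (\<phi> z)) +
             (p * ln p + (1 - p) * ln (1 - p)) * (\<Sum>j=1..i. mean p {1..m} (\<lambda>z. of_bool (bad j z))))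
         \<le> mean p {1..m} (\<lambda>Y. mean p {1..m} (\<lambda>Y'. of_bool (avoids bad i Y Y') * \<phi> (path_vertex i Y Y')))"
  using assms(2,3)
proof (induction i arbitrary: \<phi>)
  case 0
  have "mean p {1..m} (\<lambda>Y. mean p {1..m} (\<lambda>Y'. of_bool (avoids bad 0 Y Y') * \<phi> (path_vertex 0 Y Y'))) =
        mean p {1..m} (\<lambda>Y. mean p {1..m} (\<lambda>Y'. \<phi> Y))"
    by (intro mean_cong) (simp_all add: path_vertex_0 avoids_def)
  also have "\<dots> = mean p {1..m} \<phi>" by simp
  finally show ?case using exp_mean_ln_le[of "{1..m}" \<phi> p] 0 by simp
next
  case (Suc i)
  define a where "a = Suc i"
  have a: "a \<in> {1..m}" using Suc.prems by (simp add: a_def)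
  \<comment> \<open>\<open>H\<close> is minus the entropy of one bit, the expected logarithm of the
    probability of the bit kept at a refusal.\<close>
  define H where "H = p * ln p + (1 - p) * ln (1 - p)"
  define P where "P z = (if z a = 1 then p else 1 - p)" for z :: "nat \<Rightarrow> real"
  \<comment> \<open>The new test function averages over bit \<open>a\<close> of \<open>Y'\<close>:
    at a bad edge only the present bit survives, with probability \<open>P z\<close>; elsewhere both
    values contribute.\<close>
  define \<psi> where "\<psi> z = (if bad a z then P z * \<phi> z else p * \<phi> (z(a := 1)) + (1 - p) * \<phi> (z(a := 0)))" for z
  have P_pos: "0 < P z" for z using p by (simp add: P_def)
  have \<psi>_pos: "0 < \<psi> z" for z
    using p Suc.prems(2) by (simp add: \<psi>_def P_pos add_pos_pos)
  have step: "mean p {1..m} (\<lambda>Y. mean p {1..m} (\<lambda>Y'. of_bool (avoids bad a Y Y') * \<phi> (path_vertex a Y Y'))) =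
     mean p {1..m} (\<lambda>Y. mean p {1..m} (\<lambda>Y'. of_bool (avoids bad i Y Y') * \<psi> (path_vertex i Y Y')))"
  proof (rule mean_cong)
    fix Y :: "nat \<Rightarrow> real" assume Y: "Y \<in> PiE_dflt {1..m} 0 (\<lambda>_. {0, 1})"
    then have Ya: "Y a \<in> {0, 1}" using a by (auto simp: PiE_dflt_def)
    have pva: "path_vertex i Y Y' a = Y a" for Y'
      by (simp add: path_vertex_def a_def)
    have upd: "(path_vertex i Y Y')(a := Y a) = path_vertex i Y Y'" for Y'
      using pva[of Y'] by (metis fun_upd_triv)
    have "mean p {1..m} (\<lambda>Y'. of_bool (avoids bad a Y Y') * \<phi> (path_vertex a Y Y')) =
      mean p {1..m} (\<lambda>Y'. p * (of_bool (avoids bad a Y (Y'(a := 1))) * \<phi> (path_vertex a Y (Y'(a := 1)))) +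
        (1 - p) * (of_bool (avoids bad a Y (Y'(a := 0))) * \<phi> (path_vertex a Y (Y'(a := 0)))))"
      using a by (intro mean_resample[OF p, symmetric]) auto
    also have "\<dots> = mean p {1..m} (\<lambda>Y'. of_bool (avoids bad i Y Y') * \<psi> (path_vertex i Y Y'))"
    proof (rule mean_cong)
      fix Y' :: "nat \<Rightarrow> real"
      show "p * (of_bool (avoids bad a Y (Y'(a := 1))) * \<phi> (path_vertex a Y (Y'(a := 1)))) +
        (1 - p) * (of_bool (avoids bad a Y (Y'(a := 0))) * \<phi> (path_vertex a Y (Y'(a := 0)))) =
        of_bool (avoids bad i Y Y') * \<psi> (path_vertex i Y Y')"
        using Ya upd[of Y'] pva[of Y']
        unfolding a_def avoids_Suc_upd path_vertex_Suc_upd \<psi>_def P_def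
        by auto
    qed simp
    finally show "mean p {1..m} (\<lambda>Y'. of_bool (avoids bad a Y Y') * \<phi> (path_vertex a Y Y')) =
      mean p {1..m} (\<lambda>Y'. of_bool (avoids bad i Y Y') * \<psi> (path_vertex i Y Y'))" .
  qed simp
  have "mean p {1..m} (\<lambda>z. ln (\<phi> z)) + H * mean p {1..m} (\<lambda>z. of_bool (bad a z)) =
     mean p {1..m} (\<lambda>z. of_bool (bad a z) * ln (\<phi> z)) + mean p {1..m} (\<lambda>z. of_bool (\<not> bad a z) * ln (\<phi> z))
     + mean p {1..m} (\<lambda>z. p * (of_bool (bad a z) * ln p) + (1 - p) * (of_bool (bad a z) * ln (1 - p)))"
  proof -
    have "mean p {1..m} (\<lambda>z. ln (\<phi> z)) =
      mean p {1..m} (\<lambda>z. of_bool (bad a z) * ln (\<phi> z) + of_bool (\<not> bad a z) * ln (\<phi> z))"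
      by (intro mean_cong) auto
    moreover have "H * mean p {1..m} (\<lambda>z. of_bool (bad a z)) =
      mean p {1..m} (\<lambda>z. p * (of_bool (bad a z) * ln p) + (1 - p) * (of_bool (bad a z) * ln (1 - p)))"
      unfolding H_def integral_mult_right_zero[symmetric]
      by (intro mean_cong) (auto simp: algebra_simps)
    ultimately show ?thesis by simp
  qed
  \<comment> \<open>As \<open>bad a z\<close> ignores bit \<open>a\<close>, redrawing that bit turns
    the entropy term into an average of \<open>ln (P z)\<close>. The same resampling then treats
    \<open>ln (\<phi> z)\<close> off the bad edges.\<close>
  also have "mean p {1..m} (\<lambda>z. p * (of_bool (bad a z) * ln p) + (1 - p) * (of_bool (bad a z) * ln (1 - p)))
     = mean p {1..m} (\<lambda>z. of_bool (bad a z) * ln (P z))"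
    using a by (subst mean_resample[OF p, of _ a, symmetric]) (auto simp: P_def bad)
  also have "mean p {1..m} (\<lambda>z. of_bool (\<not> bad a z) * ln (\<phi> z)) =
     mean p {1..m} (\<lambda>z. of_bool (\<not> bad a z) * (p * ln (\<phi> (z(a := 1))) + (1 - p) * ln (\<phi> (z(a := 0)))))"
    using a by (subst mean_resample[OF p, of _ a, symmetric]) (auto simp: bad algebra_simps)
  also have "mean p {1..m} (\<lambda>z. of_bool (bad a z) * ln (\<phi> z)) +
      mean p {1..m} (\<lambda>z. of_bool (\<not> bad a z) * (p * ln (\<phi> (z(a := 1))) + (1 - p) * ln (\<phi> (z(a := 0))))) +
      mean p {1..m} (\<lambda>z. of_bool (bad a z) * ln (P z)) =
    mean p {1..m} (\<lambda>z. of_bool (bad a z) * ln (\<phi> z) +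
      of_bool (\<not> bad a z) * (p * ln (\<phi> (z(a := 1))) + (1 - p) * ln (\<phi> (z(a := 0)))) +
      of_bool (bad a z) * ln (P z))"
    by simp
  \<comment> \<open>Equality at bad edges by the product rule for \<open>ln\<close>, concavity of
    \<open>ln\<close> elsewhere.\<close>
  also have "\<dots> \<le> mean p {1..m} (\<lambda>z. ln (\<psi> z))"
    using Suc.prems(2) P_pos
    by (intro mean_mono) (auto simp: \<psi>_def ln_mult_pos[OF P_pos Suc.prems(2)] ln_mix_ge)
  finally have le: "mean p {1..m} (\<lambda>z. ln (\<phi> z)) + H * mean p {1..m} (\<lambda>z. of_bool (bad a z))
    \<le> mean p {1..m} (\<lambda>z. ln (\<psi> z))" .
  have "exp (mean p {1..m} (\<lambda>z. ln (\<phi> z)) + H * (\<Sum>j=1..a. mean p {1..m} (\<lambda>z. of_bool (bad j z))))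
     \<le> exp (mean p {1..m} (\<lambda>z. ln (\<psi> z)) + H * (\<Sum>j=1..i. mean p {1..m} (\<lambda>z. of_bool (bad j z))))"
    using le by (simp add: a_def algebra_simps)
  also have "\<dots> \<le> mean p {1..m} (\<lambda>Y. mean p {1..m} (\<lambda>Y'. of_bool (avoids bad i Y Y') * \<psi> (path_vertex i Y Y')))"
    unfolding H_def by (rule Suc.IH) (use Suc.prems \<psi>_pos in auto)
  finally show ?case
    unfolding step[symmetric] H_def a_def .
qed

end

text \<open>With signs reversed this bounds the entropy from above: \<open>ln (1 - p)\<close> is at
  least \<open>2 * p * ln p\<close>, and \<open>2 * (1 - p) \<ge> 1\<close> handles the term
  \<open>p * ln p\<close>. The factor \<open>p * (1 - p)\<close> is chosen to match the one in
  \<open>total_influence_le\<close>.\<close>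

lemma binary_entropy_ge:
  fixes p :: real
  assumes "0 < p" "p \<le> 1 / 2"
  shows "4 * (p * (1 - p)) * ln p \<le> p * ln p + (1 - p) * ln (1 - p)"
proof -
  have ln_p: "ln p \<le> ln (1 / 2)" "ln (1 / 2) < (0::real)"
    using assms by (subst ln_le_cancel_iff) (auto simp: ln_div)
  \<comment> \<open>Concavity between \<open>1/2\<close> and \<open>1\<close> with weight
    \<open>2 * p\<close>; \<open>ln_mix_ge\<close> needs a weight below \<open>1\<close>, so
    \<open>p = 1/2\<close> is separate.\<close>
  have "2 * p * ln (1 / 2) \<le> ln (1 - p)"
  proof (cases "p = 1 / 2")
    case False
    then show ?thesis using ln_mix_ge[of "2 * p" "1 / 2" 1] assms by simp
  next
    case True
    show ?thesis unfolding True by simp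
  qed
  moreover have "2 * p * ln p \<le> 2 * p * ln (1 / 2)"
    using ln_p assms by (intro mult_left_mono) auto
  ultimately have "2 * p * ln p \<le> ln (1 - p)" by (rule order_trans[rotated])
  then have "(1 - p) * (2 * p * ln p) \<le> (1 - p) * ln (1 - p)"
    using assms by (intro mult_left_mono) auto
  moreover have "(2 * (1 - p)) * (p * ln p) \<le> 1 * (p * ln p)"
    using ln_p assms by (intro mult_right_mono_neg) (auto simp: mult_le_0_iff)
  ultimately show ?thesis by (simp add: algebra_simps)
qed

section \<open>Low-degree polynomials along a random path\<close>

lemma cube_eq: "cube N = PiE_dflt {1..N} 0 (\<lambda>_. {0, 1})"
  by (simp add: cube_def)

lemma finite_cube: "finite (cube N)"
  by (auto simp: cube_def)

lemma set_biased_cube: "z \<in> set_pmf (biased p {1..N}) \<Longrightarrow> z \<in> cube N"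
  unfolding cube_eq by (rule set_biased_subset) auto

lemma path_vertex_cube: "Y \<in> cube m \<Longrightarrow> Y' \<in> cube m \<Longrightarrow> path_vertex i Y Y' \<in> cube m"
  by (auto simp: cube_def PiE_dflt_def path_vertex_def)

text \<open>On the cube every monomial agrees with its squarefree part.\<close>

lemma eval_mpoly_cube_eq_multilin:
  assumes "q \<in> mpolys_deg_le N D"
  obtains c where "\<And>S. D < card S \<Longrightarrow> c S = 0"
    and "\<And>z. z \<in> cube N \<Longrightarrow> eval_mpoly q z = multilin c {1..N} z"
proof
  \<comment> \<open>Monomials with the same set of variables merge into one coefficient. A monomial
    has at most as many variables as its degree, so \<open>c\<close> inherits the bound
    \<open>D\<close>.\<close>
  define c where "c S = (\<Sum>\<alpha>\<in>{\<alpha> \<in> Poly_Mapping.keys q. Poly_Mapping.keys \<alpha> = S}. Poly_Mapping.lookup q \<alpha>)" for S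
  note q = assms[unfolded mpolys_deg_le_def mem_Collect_eq, rule_format]
  have card: "card (Poly_Mapping.keys \<alpha>) \<le> D" if "\<alpha> \<in> Poly_Mapping.keys q" for \<alpha>
  proof -
    have "card (Poly_Mapping.keys \<alpha>) = (\<Sum>j\<in>Poly_Mapping.keys \<alpha>. 1)" by simp
    also have "\<dots> \<le> (\<Sum>j\<in>Poly_Mapping.keys \<alpha>. Poly_Mapping.lookup \<alpha> j)"
      by (intro sum_mono) (simp add: in_keys_iff Suc_leI)
    also have "\<dots> \<le> D" using q[OF that] by simp
    finally show ?thesis .
  qed
  show "c S = 0" if "D < card S" for S
    unfolding c_def using card that by (intro sum.neutral) fastforce
  show "eval_mpoly q z = multilin c {1..N} z" if z: "z \<in> cube N" for z
  proof -
    have pow: "z j ^ Poly_Mapping.lookup \<alpha> j = z j"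
      if "\<alpha> \<in> Poly_Mapping.keys q" "j \<in> Poly_Mapping.keys \<alpha>" for \<alpha> j
    proof -
      have "j \<in> {1..N}" using q[OF that(1)] that(2) by auto
      moreover have "Poly_Mapping.lookup \<alpha> j \<noteq> 0" using that(2) by (simp add: in_keys_iff)
      moreover from \<open>j \<in> {1..N}\<close> have "z j = 0 \<or> z j = 1"
        using z by (auto simp: cube_def PiE_dflt_def)
      ultimately show ?thesis by auto
    qed
    have "eval_mpoly q z =
        (\<Sum>\<alpha>\<in>Poly_Mapping.keys q. Poly_Mapping.lookup q \<alpha> * (\<Prod>j\<in>Poly_Mapping.keys \<alpha>. z j))"
      unfolding eval_mpoly_def
      by (intro sum.cong refl arg_cong2[of _ _ _ _ "(*)"] prod.cong) (auto simp: pow)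
    also have "\<dots> = (\<Sum>S\<in>Pow {1..N}. \<Sum>\<alpha>\<in>{\<alpha> \<in> Poly_Mapping.keys q. Poly_Mapping.keys \<alpha> = S}.
        Poly_Mapping.lookup q \<alpha> * (\<Prod>j\<in>Poly_Mapping.keys \<alpha>. z j))"
      by (rule sum.group[symmetric]) (use q in auto)
    also have "\<dots> = multilin c {1..N} z"
      unfolding multilin_def c_def sum_distrib_right by (intro sum.cong refl) auto
    finally show ?thesis .
  qed
qed

text \<open>By Markov's inequality the probabilities of bad edges, summed over all directions, are
  at most the total influence divided by \<open>T\<close>, hence at most
  \<open>D * K / (p * (1 - p) * T)\<close>. Then \<open>mean_avoids_ge\<close> with test function
  \<open>1\<close> gives a lower bound, and \<open>binary_entropy_ge\<close> cancels
  \<open>p * (1 - p)\<close>.\<close>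

lemma no_large_step_prob_ge:
  fixes F :: "'i \<Rightarrow> (nat \<Rightarrow> real) \<Rightarrow> real"
  assumes p: "0 < p" "p \<le> 1 / 2" and "finite I" "0 < T"
    and deg: "\<And>i S. i \<in> I \<Longrightarrow> D < card S \<Longrightarrow> c i S = 0"
    and F: "\<And>i z. i \<in> I \<Longrightarrow> z \<in> cube m \<Longrightarrow> F i z = multilin (c i) {1..m} z"
    and K: "mean p {1..m} (\<lambda>z. \<Sum>i\<in>I. (F i z)\<^sup>2) \<le> K"
  shows "exp (4 * real D * K / T * ln p) \<le>
    measure_pmf.prob (pair_pmf (biased p {1..m}) (biased p {1..m}))
      {(Y, Y'). \<forall>j\<in>{1..m}. (\<Sum>i\<in>I. (F i (path_vertex (j - 1) Y Y') - F i (path_vertex j Y Y'))\<^sup>2) \<le> T}"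
proof -
  have p': "p < 1" using p by simp
  \<comment> \<open>The squared jump across the edge in direction \<open>j\<close> at
    \<open>z\<close>. It ignores \<open>z j\<close>, as \<open>mean_avoids_ge\<close> requires of
    \<open>bad\<close>.\<close>
  define V where "V j z = (\<Sum>i\<in>I. (multilin (c i) {1..m} (z(j := 1)) - multilin (c i) {1..m} (z(j := 0)))\<^sup>2)" for j z
  define bad where "bad j z = (T < V j z)" for j z
  define Q where "Q = (\<Sum>j=1..m. mean p {1..m} (\<lambda>z. of_bool (bad j z)))"
  define G where "G = {(Y, Y'). \<forall>j\<in>{1..m}. (\<Sum>i\<in>I. (F i (path_vertex (j - 1) Y Y') - F i (path_vertex j Y Y'))\<^sup>2) \<le> T}"
  have "T * Q = (\<Sum>j=1..m. mean p {1..m} (\<lambda>z. T * of_bool (bad j z)))"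
    by (simp add: Q_def sum_distrib_left)
  also have "\<dots> \<le> (\<Sum>j=1..m. mean p {1..m} (V j))"
    by (intro sum_mono mean_mono) (auto simp: bad_def V_def intro: sum_nonneg)
  also have "\<dots> = (\<Sum>i\<in>I. \<Sum>j=1..m. mean p {1..m} (\<lambda>z. (multilin (c i) {1..m} (z(j := 1)) - multilin (c i) {1..m} (z(j := 0)))\<^sup>2))"
    unfolding V_def by (subst sum.swap) simp
  finally have "p * (1 - p) * (T * Q) \<le> p * (1 - p) * \<dots>"
    using p by (intro mult_left_mono) auto
  also have "\<dots> = (\<Sum>i\<in>I. p * (1 - p) * (\<Sum>j=1..m. mean p {1..m} (\<lambda>z. (multilin (c i) {1..m} (z(j := 1)) - multilin (c i) {1..m} (z(j := 0)))\<^sup>2)))"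
    by (simp add: sum_distrib_left)
  also have "\<dots> \<le> (\<Sum>i\<in>I. D * mean p {1..m} (\<lambda>z. (multilin (c i) {1..m} z)\<^sup>2))"
    using deg by (intro sum_mono total_influence_le[OF p(1) p']) auto
  also have "\<dots> = D * mean p {1..m} (\<lambda>z. \<Sum>i\<in>I. (multilin (c i) {1..m} z)\<^sup>2)"
    by (simp add: sum_distrib_left)
  also have "mean p {1..m} (\<lambda>z. \<Sum>i\<in>I. (multilin (c i) {1..m} z)\<^sup>2) = mean p {1..m} (\<lambda>z. \<Sum>i\<in>I. (F i z)\<^sup>2)"
    by (intro mean_cong) (simp_all add: F cube_eq)
  also have "D * \<dots> \<le> D * K" using K by (intro mult_left_mono) auto
  finally have Q: "p * (1 - p) * Q \<le> D * K / T"
    using \<open>0 < T\<close> by (simp add: field_simps)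
  have "4 * real D * K / T * ln p = 4 * ln p * (D * K / T)" by simp
  also have "\<dots> \<le> 4 * ln p * (p * (1 - p) * Q)"
    using Q p by (intro mult_left_mono_neg) (auto simp: ln_le_zero_iff)
  also have "\<dots> = 4 * (p * (1 - p)) * ln p * Q" by simp
  also have "\<dots> \<le> (p * ln p + (1 - p) * ln (1 - p)) * Q"
    by (intro mult_right_mono binary_entropy_ge p) (auto simp: Q_def intro!: sum_nonneg)
  finally have "exp (4 * real D * K / T * ln p) \<le> exp ((p * ln p + (1 - p) * ln (1 - p)) * Q)"
    by simp
  also have "\<dots> \<le> mean p {1..m} (\<lambda>Y. mean p {1..m} (\<lambda>Y'. of_bool (avoids bad m Y Y')))"
    using mean_avoids_ge[OF p(1) p', of bad m m "\<lambda>_. 1"] by (simp add: bad_def V_def Q_def)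
  also have "\<dots> \<le> mean p {1..m} (\<lambda>Y. mean p {1..m} (\<lambda>Y'. indicator G (Y, Y')))"
  proof (intro mean_mono)
    fix Y Y' :: "nat \<Rightarrow> real"
    assume Y: "Y \<in> PiE_dflt {1..m} 0 (\<lambda>_. {0, 1})" "Y' \<in> PiE_dflt {1..m} 0 (\<lambda>_. {0, 1::real})"
    have "(Y, Y') \<in> G" if "avoids bad m Y Y'"
      unfolding G_def
    proof (clarify)
      fix j assume j: "j \<in> {1..m}"
      define z where "z = path_vertex (j - 1) Y Y'"
      have cube: "path_vertex i Y Y' \<in> cube m" for i
        using Y by (intro path_vertex_cube) (auto simp: cube_eq)
      have z': "path_vertex j Y Y' = z(j := Y' j)" and zj: "z j = Y j"
        using j by (auto simp: z_def path_vertex_def fun_eq_iff)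
      have Yj: "Y j \<in> {0, 1}" "Y' j \<in> {0, 1}"
        using Y j by (auto simp: PiE_dflt_def)
      have "(\<Sum>i\<in>I. (F i z - F i (path_vertex j Y Y'))\<^sup>2) =
        (\<Sum>i\<in>I. (multilin (c i) {1..m} (z(j := Y j)) - multilin (c i) {1..m} (z(j := Y' j)))\<^sup>2)"
        using cube[of j] cube[of "j - 1", folded z_def] zj
        by (intro sum.cong refl) (simp add: F z' fun_upd_idem)
      \<comment> \<open>A step that keeps the bit leaves \<open>F\<close> unchanged; otherwise
        \<open>avoids\<close> says that the crossed edge is not bad.\<close>
      also have "\<dots> \<le> T"
      proof (cases "Y j = Y' j")
        case True
        then show ?thesis using \<open>0 < T\<close> by simp
      next
        case False
        then have "\<not> bad j z"
          using that j by (auto simp: avoids_def z_def)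
        then show ?thesis
          using False Yj by (auto simp: bad_def V_def power2_commute)
      qed
      finally show "(\<Sum>i\<in>I. (F i (path_vertex (j - 1) Y Y') - F i (path_vertex j Y Y'))\<^sup>2) \<le> T"
        by (simp add: z_def)
    qed
    then show "of_bool (avoids bad m Y Y') \<le> (indicator G (Y, Y') :: real)" by auto
  qed auto
  also have "\<dots> = measure_pmf.prob (pair_pmf (biased p {1..m}) (biased p {1..m})) G"
    by (subst expectation_pair_pmf_finite[symmetric]) auto
  finally show ?thesis unfolding G_def .
qed

lemma prob_path_vertex:
  assumes "0 < p" "p < 1" "i \<le> m"
  shows "measure_pmf.prob (pair_pmf (biased p {1..m}) (biased p {1..m}))
      {(Y, Y'). path_vertex i Y Y' \<in> S} = measure_pmf.prob (biased p {1..m}) S"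
proof -
  have "measure_pmf.prob (pair_pmf (biased p {1..m}) (biased p {1..m})) {(Y, Y'). path_vertex i Y Y' \<in> S}
    = measure_pmf.expectation (pair_pmf (biased p {1..m}) (biased p {1..m}))
        (indicator {(Y, Y'). path_vertex i Y Y' \<in> S})"
    by simp
  also have "\<dots> = mean p {1..m} (\<lambda>Y. mean p {1..m} (\<lambda>Y'. indicator S (path_vertex i Y Y')))"
    by (subst expectation_pair_pmf_finite) (auto simp: indicator_def)
  also have "\<dots> = mean p {1..m} (indicator S)"
    by (rule mean_path_vertex[OF assms])
  finally show ?thesis by simp
qed

section \<open>Rounding and the overlap gap\<close>

text \<open>A lost vertex has value at least \<open>1\<close> at \<open>Y\<close>. At
  \<open>Y'\<close> it was deleted as conflicting, or has a value in \<open>(1/2, 1)\<close>, or has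
  dropped by at least \<open>1/2\<close>. Success of the rounding at \<open>Y'\<close> bounds the
  first two kinds by \<open>\<eta> * n\<close>, and each vertex of the third kind adds at least
  \<open>1/4\<close> to the squared distance.\<close>

lemma card_rounded_diff_le:
  assumes "rounded n e \<eta> f Y' \<omega> \<noteq> {}"
  shows "real (card (rounded n e \<eta> f Y \<omega> - rounded n e \<eta> f Y' \<omega>)) \<le>
           \<eta> * n + 4 * (\<Sum>i=1..n. (f Y \<omega> i - f Y' \<omega> i)\<^sup>2)"
proof -
  define A where "A Y = {i \<in> {1..n}. 1 \<le> f Y \<omega> i}" for Y
  define A' where "A' Y = {i \<in> A Y. \<forall>v\<in>A Y. \<not> adjacent n e Y i v}" for Y
  define B where "B = {i \<in> {1..n}. 1/2 < f Y' \<omega> i \<and> f Y' \<omega> i < 1}"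
  define J where "J = {i \<in> {1..n}. 1/2 \<le> f Y \<omega> i - f Y' \<omega> i}"
  have r: "rounded n e \<eta> f Y' \<omega> = A' Y'" and small: "real (card (A Y' - A' Y')) + card B \<le> \<eta> * n"
    using assms by (auto simp: rounded_def Let_def A_def A'_def B_def split: if_splits)
  have "rounded n e \<eta> f Y \<omega> \<subseteq> A Y"
    by (auto simp: rounded_def Let_def A_def)
  then have "rounded n e \<eta> f Y \<omega> - A' Y' \<subseteq> (A Y' - A' Y') \<union> B \<union> J"
    by (auto simp: A_def B_def J_def)
  moreover have fin: "finite (A Y' - A' Y')" "finite B" "finite J"
    by (auto simp: A_def B_def J_def)
  ultimately have "card (rounded n e \<eta> f Y \<omega> - A' Y') \<le> card ((A Y' - A' Y') \<union> B \<union> J)"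
    by (intro card_mono) auto
  also have "\<dots> \<le> card (A Y' - A' Y') + card B + card J"
    by (meson add_le_mono card_Un_le le_refl order_trans)
  finally have "real (card (rounded n e \<eta> f Y \<omega> - A' Y')) \<le> \<eta> * n + card J"
    using small by linarith
  moreover have "real (card J) \<le> 4 * (\<Sum>i=1..n. (f Y \<omega> i - f Y' \<omega> i)\<^sup>2)"
  proof -
    have "real (card J) = (\<Sum>i\<in>J. 1)" by simp
    also have "\<dots> \<le> (\<Sum>i\<in>J. 4 * (f Y \<omega> i - f Y' \<omega> i)\<^sup>2)"
    proof (intro sum_mono)
      fix i assume "i \<in> J"
      then have "(1/2)\<^sup>2 \<le> (f Y \<omega> i - f Y' \<omega> i)\<^sup>2"
        by (intro power_mono) (auto simp: J_def)
      then show "1 \<le> 4 * (f Y \<omega> i - f Y' \<omega> i)\<^sup>2" by (simp add: power2_eq_square)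
    qed
    also have "\<dots> \<le> (\<Sum>i=1..n. 4 * (f Y \<omega> i - f Y' \<omega> i)\<^sup>2)"
      by (intro sum_mono2) (auto simp: J_def)
    finally show ?thesis by (simp add: sum_distrib_left)
  qed
  ultimately show ?thesis by (simp add: r)
qed

lemma rounded_indep: "rounded n e \<eta> f Y \<omega> \<in> indep_sets_of n e Y"
  by (auto simp: rounded_def indep_sets_of_def Let_def)

text \<open>First moment method: the second moment over \<open>3 * (\<gamma> * real k)\<close> plus
  the failure indicator over \<open>3 * \<delta>'\<close> has mean below \<open>1\<close>. Some seed
  therefore has conditional mean below \<open>1\<close>, and then neither nonnegative summand
  reaches \<open>1\<close>. Since \<open>\<delta>'\<close> is positive, the division makes sense
  also for \<open>\<delta> = 0\<close>.\<close>

lemma exists_good_seed: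
  assumes f: "random_polynomial n D \<Omega> f" and opt: "optimizes n e d \<Omega> f k \<delta> \<gamma> \<eta>"
    and "\<delta> < 1" "\<delta> < \<delta>'" "0 < \<delta>'" "0 < \<gamma> * real k"
  obtains \<omega> where "\<omega> \<in> space \<Omega>"
    and "measure_pmf.expectation (gnp n (d / real n))
           (\<lambda>Y. indicator (cube (n choose 2)) Y * (\<Sum>i=1..n. (f Y \<omega> i)\<^sup>2)) \<le> 3 * (\<gamma> * real k)"
    and "measure_pmf.prob (gnp n (d / real n))
           {Y \<in> cube (n choose 2). k \<le> card (rounded n e \<eta> f Y \<omega>)} \<ge> 1 - 3 * \<delta>'"
proof -
  define G where "G = gnp n (d / real n)"
  define N where "N = n choose 2"
  define K where "K = \<gamma> * real k"
  define M where "M = measure_pmf G \<Otimes>\<^sub>M \<Omega>"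
  define W where "W = {(Y, \<omega>). Y \<in> cube N \<and> \<omega> \<in> space \<Omega> \<and> k \<le> card (rounded n e \<eta> f Y \<omega>)}"
  define s where "s Y \<omega> = indicator (cube N) Y * (\<Sum>i=1..n. (f Y \<omega> i)\<^sup>2)" for Y \<omega>
  have K: "0 < K" using assms by (simp add: K_def)
  have meas_f: "(\<lambda>\<omega>. f Y \<omega> i) \<in> borel_measurable \<Omega>" if "Y \<in> cube N" "i \<in> {1..n}" for Y i
    using f that by (simp add: random_polynomial_def N_def)
  interpret \<Omega>: prob_space \<Omega> using f by (simp add: random_polynomial_def)
  interpret MP: pair_prob_space "measure_pmf G" \<Omega> ..
  have int: "(\<integral>\<^sup>+ (Y, \<omega>). ennreal (\<Sum>i\<in>{1..n}. (f Y \<omega> i)\<^sup>2) \<partial>M) \<le> ennreal K"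
    and prob: "measure M W \<ge> 1 - \<delta>"
    using opt by (simp_all add: optimizes_def Let_def M_def G_def K_def W_def N_def)
  text \<open>A non-measurable set would have measure \<open>0\<close>.\<close>
  have W: "W \<in> sets M"
    using prob \<open>\<delta> < 1\<close> measure_notin_sets[of W M] by fastforce
  \<comment> \<open>Measurability of \<open>f\<close> is known only for each fixed \<open>Y\<close>
    in the cube, hence the cutoff in \<open>s\<close>; summing over the finitely many points gives
    joint measurability.\<close>
  have s_meas: "(\<lambda>x. s (fst x) (snd x)) \<in> borel_measurable M"
  proof -
    have "(\<lambda>x. \<Sum>y\<in>cube N. indicator {y} (fst x) * (\<Sum>i=1..n. (f y (snd x) i)\<^sup>2)) \<in> borel_measurable M"
    proof (intro borel_measurable_sum borel_measurable_times borel_measurable_power)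
      fix y i assume "y \<in> cube N" "i \<in> {1..n}"
      from meas_f[OF this] show "(\<lambda>x. f y (snd x) i) \<in> borel_measurable M"
        unfolding M_def by (rule measurable_compose[OF measurable_snd])
    next
      fix y
      have "indicator {y} \<in> borel_measurable (measure_pmf G)" by simp
      then show "(\<lambda>x. indicator {y} (fst x)) \<in> borel_measurable M"
        unfolding M_def by (rule measurable_compose[OF measurable_fst])
    qed
    also have "(\<lambda>x. \<Sum>y\<in>cube N. indicator {y} (fst x) * (\<Sum>i=1..n. (f y (snd x) i)\<^sup>2)) = (\<lambda>x. s (fst x) (snd x))"
    proof (rule ext)
      fix x
      have "(\<Sum>y\<in>cube N. indicator {y} (fst x) * (\<Sum>i=1..n. (f y (snd x) i)\<^sup>2)) =
        (\<Sum>y\<in>cube N. if y = fst x then (\<Sum>i=1..n. (f (fst x) (snd x) i)\<^sup>2) else 0)"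
        by (intro sum.cong) auto
      then show "(\<Sum>y\<in>cube N. indicator {y} (fst x) * (\<Sum>i=1..n. (f y (snd x) i)\<^sup>2)) = s (fst x) (snd x)"
        by (simp add: sum.delta finite_cube s_def indicator_def)
    qed
    finally show ?thesis .
  qed
  define h where "h = (\<lambda>(Y, \<omega>). s Y \<omega> / (3 * K) + (1 - indicator W (Y, \<omega>)) / (3 * \<delta>'))"
  have s_nonneg: "0 \<le> s Y \<omega>" for Y \<omega> by (simp add: s_def sum_nonneg)
  have h_nonneg: "0 \<le> h x" for x
    using K \<open>0 < \<delta>'\<close> s_nonneg by (auto simp: h_def split_beta indicator_def)
  have h_meas: "h \<in> borel_measurable M"
    unfolding h_def split_beta using s_meas W
    by (intro borel_measurable_add borel_measurable_divide borel_measurable_diff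
        borel_measurable_indicator) simp_all
  have "(\<integral>\<^sup>+ x. ennreal (h x) \<partial>M) =
     (\<integral>\<^sup>+ x. ennreal (1 / (3 * K)) * ennreal (s (fst x) (snd x)) +
             ennreal (1 / (3 * \<delta>')) * indicator (space M - W) x \<partial>M)"
    using K \<open>0 < \<delta>'\<close> s_nonneg
    by (intro nn_integral_cong)
       (auto simp: h_def split_beta indicator_def simp flip: ennreal_mult ennreal_plus)
  also have "\<dots> = ennreal (1 / (3 * K)) * (\<integral>\<^sup>+ x. ennreal (s (fst x) (snd x)) \<partial>M) +
     ennreal (1 / (3 * \<delta>')) * emeasure M (space M - W)"
    using s_meas W
    by (subst nn_integral_add) (auto simp: split_beta nn_integral_cmult nn_integral_cmult_indicator)
  also have "\<dots> \<le> ennreal (1 / (3 * K)) * ennreal K + ennreal (1 / (3 * \<delta>')) * ennreal \<delta>"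
  proof (intro add_mono mult_left_mono)
    have "(\<integral>\<^sup>+ x. ennreal (s (fst x) (snd x)) \<partial>M) \<le> (\<integral>\<^sup>+ (Y, \<omega>). ennreal (\<Sum>i\<in>{1..n}. (f Y \<omega> i)\<^sup>2) \<partial>M)"
      by (intro nn_integral_mono) (auto simp: s_def indicator_def split_beta)
    with int show "(\<integral>\<^sup>+ x. ennreal (s (fst x) (snd x)) \<partial>M) \<le> ennreal K" by simp
    have "measure M (space M - W) \<le> \<delta>"
      using MP.P.prob_compl[of W] W prob by (simp add: M_def)
    then show "emeasure M (space M - W) \<le> ennreal \<delta>"
      by (simp add: M_def MP.P.emeasure_eq_measure ennreal_leI)
  qed auto
  also have "\<dots> < 1"
  proof -
    have "0 \<le> \<delta>"
      using prob MP.P.prob_le_1[of W] unfolding M_def by linarith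
    then have "ennreal (1 / (3 * K)) * ennreal K + ennreal (1 / (3 * \<delta>')) * ennreal \<delta> = ennreal (1 / 3 + \<delta> / (3 * \<delta>'))"
      using K \<open>0 < \<delta>'\<close> by (simp flip: ennreal_mult ennreal_plus)
    moreover have "1 / 3 + \<delta> / (3 * \<delta>') < 1"
      using \<open>\<delta> < \<delta>'\<close> \<open>0 < \<delta>'\<close> by (simp add: field_simps)
    ultimately show ?thesis by (simp add: ennreal_less_one_iff)
  qed
  finally have "(\<integral>\<^sup>+ \<omega>. \<integral>\<^sup>+ Y. ennreal (h (Y, \<omega>)) \<partial>measure_pmf G \<partial>\<Omega>) < 1"
    using MP.nn_integral_snd[of "\<lambda>x. ennreal (h x)"] h_meas by (simp add: M_def)
  \<comment> \<open>If every seed had conditional mean at least \<open>1\<close>, so would the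
    total, since \<open>\<Omega>\<close> has mass \<open>1\<close>.\<close>
  moreover have "(\<integral>\<^sup>+ \<omega>. \<integral>\<^sup>+ Y. ennreal (h (Y, \<omega>)) \<partial>measure_pmf G \<partial>\<Omega>) \<ge> (\<integral>\<^sup>+ \<omega>. 1 \<partial>\<Omega>)"
    if "\<And>\<omega>. \<omega> \<in> space \<Omega> \<Longrightarrow> 1 \<le> (\<integral>\<^sup>+ Y. ennreal (h (Y, \<omega>)) \<partial>measure_pmf G)"
    using that by (intro nn_integral_mono) auto
  ultimately obtain \<omega> where \<omega>: "\<omega> \<in> space \<Omega>" "(\<integral>\<^sup>+ Y. ennreal (h (Y, \<omega>)) \<partial>measure_pmf G) < 1"
    by (fastforce simp: \<Omega>.emeasure_space_1 not_le)
  have [simp]: "integrable (measure_pmf G) g" for g :: "_ \<Rightarrow> real"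
    unfolding G_def gnp_def by simp
  have "measure_pmf.expectation G (\<lambda>Y. h (Y, \<omega>)) < 1"
    using \<omega>(2) by (subst (asm) nn_integral_eq_integral) (auto simp: h_nonneg ennreal_less_one_iff)
  moreover define A where "A = {Y \<in> cube N. k \<le> card (rounded n e \<eta> f Y \<omega>)}"
  have "(\<lambda>Y. h (Y, \<omega>)) = (\<lambda>Y. s Y \<omega> / (3 * K) + (1 - indicator A Y) / (3 * \<delta>'))"
    using \<omega>(1) by (auto simp: h_def W_def A_def indicator_def fun_eq_iff)
  ultimately have "measure_pmf.expectation G (\<lambda>Y. s Y \<omega>) / (3 * K) + (1 - measure_pmf.prob G A) / (3 * \<delta>') < 1"
    by simp
  moreover have "0 \<le> measure_pmf.expectation G (\<lambda>Y. s Y \<omega>) / (3 * K)"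
    using K s_nonneg by simp
  moreover have "0 \<le> (1 - measure_pmf.prob G A) / (3 * \<delta>')"
    using \<open>0 < \<delta>'\<close> by simp
  ultimately have "measure_pmf.expectation G (\<lambda>Y. s Y \<omega>) / (3 * K) < 1" "(1 - measure_pmf.prob G A) / (3 * \<delta>') < 1"
    by linarith+
  then have "measure_pmf.expectation G (\<lambda>Y. s Y \<omega>) \<le> 3 * K" "measure_pmf.prob G A \<ge> 1 - 3 * \<delta>'"
    using K \<open>0 < \<delta>'\<close> by (simp_all add: field_simps)
  with \<omega>(1) show ?thesis
    using that[of \<omega>] by (simp add: s_def A_def G_def N_def K_def)
qed

section \<open>Independent sets as points of the cube\<close>

definition ind_vec :: "nat set \<Rightarrow> nat \<Rightarrow> real" where
  "ind_vec S = (\<lambda>i. of_bool (i \<in> S))"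

lemma ind_vec_cube: "S \<subseteq> {1..n} \<Longrightarrow> ind_vec S \<in> cube n"
  by (auto simp: ind_vec_def cube_def PiE_dflt_def)

lemma objective_ind_vec: "S \<in> indep_sets_of n e Y \<Longrightarrow> objective n e Y (ind_vec S) = card S"
proof -
  assume S: "S \<in> indep_sets_of n e Y"
  then have "support_set n (ind_vec S) = S"
    by (auto simp: support_set_def ind_vec_def indep_sets_of_def)
  with S show ?thesis by (simp add: objective_def)
qed

lemma overlap_ind_vec:
  assumes "S \<subseteq> {1..n}"
  shows "overlap n (ind_vec S) (ind_vec T) = card (S \<inter> T) / n"
proof -
  have "(\<Sum>i\<in>{1..n}. ind_vec S i * ind_vec T i) = (\<Sum>i\<in>{1..n}. of_bool (i \<in> S \<inter> T))"
    by (intro sum.cong) (auto simp: ind_vec_def)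
  also have "\<dots> = card (S \<inter> T)"
    using assms by (subst sum_of_bool_eq) (auto intro!: arg_cong[where f = card])
  finally show ?thesis by (simp add: overlap_def)
qed

text \<open>The overlap with the first solution starts at \<open>\<ge> \<nu>\<^sub>2\<close> and ends at \<open>\<le> \<nu>\<^sub>1\<close>, hence it has
  to jump over the gap in a single step.\<close>

lemma overlap_gap_jump:
  assumes "0 < n"
    and Y: "Y \<in> cube (n choose 2)" "Y' \<in> cube (n choose 2)"
    and nu: "\<nu>1 < \<nu>2" "\<nu>2 * real n \<le> real k"
    and ogp: "overlap_gap n (path_family n e Y Y') (real k) \<nu>1 \<nu>2"
    and sep: "separated_above n (objective n e Y) (objective n e Y') \<nu>1 (real k)"
    and V: "\<And>i. i \<le> n choose 2 \<Longrightarrow> V i \<in> indep_sets_of n e (path_vertex i Y Y')"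
    and card: "\<And>i. i \<le> n choose 2 \<Longrightarrow> k \<le> card (V i)"
  obtains i where "i < n choose 2" "(\<nu>2 - \<nu>1) * n \<le> card (V i - V (Suc i))" "0 \<le> \<nu>1"
proof -
  define m where "m = n choose 2"
  define R where "R i = overlap n (ind_vec (V 0)) (ind_vec (V i))" for i
  have sub: "V i \<subseteq> {1..n}" if "i \<le> m" for i
    using V[of i] that by (auto simp: m_def indep_sets_of_def)
  have R: "R i = card (V 0 \<inter> V i) / n" for i
    unfolding R_def by (rule overlap_ind_vec) (rule sub, simp)
  have ends: "path_vertex 0 Y Y' = Y" "path_vertex m Y Y' = Y'"
    using Y by (auto simp: path_vertex_def fun_eq_iff cube_def PiE_dflt_def m_def)
  have obj: "objective n e (path_vertex i Y Y') (ind_vec (V i)) \<ge> k" if "i \<le> m" for i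
    using that V[of i] card[of i] by (simp add: objective_ind_vec m_def)
  have gap: "R i \<le> \<nu>1 \<or> \<nu>2 \<le> R i" if "i \<le> m" for i
  proof -
    have "objective n e (path_vertex i Y Y') \<in> path_family n e Y Y'"
      "objective n e (path_vertex 0 Y Y') \<in> path_family n e Y Y'"
      using that by (auto simp: path_family_def m_def)
    then have "R i \<in> {0..\<nu>1} \<union> {\<nu>2..1}"
      using ogp obj[OF that] obj[of 0] sub[OF that] sub[of 0]
      unfolding R_def overlap_gap_def by (blast intro: ind_vec_cube)
    then show ?thesis by auto
  qed
  have Rm: "R m \<le> \<nu>1"
    using sep obj[of 0] obj[of m] sub[of 0] sub[of m]
    unfolding R_def separated_above_def ends by (blast intro: ind_vec_cube)
  have "\<nu>2 \<le> real k / n"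
    using nu(2) \<open>0 < n\<close> by (simp add: field_simps)
  also have "\<dots> \<le> R 0"
    using card[of 0] \<open>0 < n\<close> by (simp add: R divide_right_mono)
  finally have R0: "\<nu>2 \<le> R 0" .
  have "\<exists>i<m. \<nu>2 \<le> R i \<and> \<not> \<nu>2 \<le> R (Suc i)"
  proof (rule ccontr)
    assume *: "\<not> (\<exists>i<m. \<nu>2 \<le> R i \<and> \<not> \<nu>2 \<le> R (Suc i))"
    have "i \<le> m \<Longrightarrow> \<nu>2 \<le> R i" for i
      by (induction i) (use R0 * in auto)
    then show False using Rm nu(1) by fastforce
  qed
  then obtain i where i: "i < m" "\<nu>2 \<le> R i" "R (Suc i) \<le> \<nu>1"
    using gap by (metis Suc_leI)
  have fin: "finite (V j)" if "j \<le> m" for j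
    using sub[OF that] finite_subset by blast
  \<comment> \<open>What the overlap with \<open>V 0\<close> loses in this step lies in
    \<open>V i - V (Suc i)\<close>.\<close>
  have "card (V 0 \<inter> V i) \<le> card ((V 0 \<inter> V (Suc i)) \<union> (V i - V (Suc i)))"
    using fin[of 0] fin[of i] i(1) by (intro card_mono) auto
  also have "\<dots> \<le> card (V 0 \<inter> V (Suc i)) + card (V i - V (Suc i))"
    by (rule card_Un_le)
  finally have le: "real (card (V 0 \<inter> V i)) \<le> real (card (V 0 \<inter> V (Suc i))) + card (V i - V (Suc i))"
    by linarith
  have "\<nu>2 * n \<le> card (V 0 \<inter> V i)" "card (V 0 \<inter> V (Suc i)) \<le> \<nu>1 * n"
    using i(2,3) \<open>0 < n\<close> by (simp_all add: R field_simps)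
  with le have "(\<nu>2 - \<nu>1) * n \<le> card (V i - V (Suc i))"
    by (simp add: left_diff_distrib)
  \<comment> \<open>Overlaps are nonnegative; together with \<open>\<nu>2 \<le> 1\<close> this later
    bounds the width of the gap by \<open>1\<close>.\<close>
  moreover have "0 \<le> \<nu>1"
    using Rm by (rule order_trans[rotated]) (simp add: R)
  ultimately show ?thesis using that[of i] i(1) by (simp add: m_def)
qed

section \<open>Failure of low-degree polynomials under the overlap gap property\<close>

theorem theorem4p2:
  fixes n m k D :: nat and e :: "nat \<Rightarrow> nat set"
    and d \<nu>1 \<nu>2 \<Delta> \<delta> \<gamma> :: real
  assumes m: "m = n choose 2"
    and e: "edge_order n e"
    and d: "0 < d" "d \<le> real n / 2"
    and nu: "\<nu>1 < \<nu>2" "\<nu>2 * real n \<le> real k"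
    and delta: "0 \<le> \<delta>" "\<delta> \<le> 1"
    and gamma: "1 \<le> \<gamma>"
    and ogp: "measure_pmf.prob (pair_pmf (gnp n (d / real n)) (gnp n (d / real n)))
        {(Y, Y'). overlap_gap n (path_family n e Y Y') (real k) \<nu>1 \<nu>2 \<and>
                  separated_above n (objective n e Y) (objective n e Y') \<nu>1 (real k)} \<ge> 1 - \<Delta>"
    and small: "\<Delta> + 3 * \<delta> * (real m + 1) <
        exp (- ((96 * \<gamma> * real D * real k * ln (real n / d)) / ((\<nu>2 - \<nu>1)\<^sup>2 * real n)))"
  shows "\<forall>\<eta>. 0 < \<eta> \<and> \<eta> \<le> 1/4 * (\<nu>2 - \<nu>1)\<^sup>2 \<longrightarrow>
           \<not> (\<exists>(\<Omega> :: 'w measure) f.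
                random_polynomial n D \<Omega> f \<and> optimizes n e d \<Omega> f k \<delta> \<gamma> \<eta>)"
proof (intro allI impI notI, elim exE conjE)
  fix \<eta> :: real and \<Omega> :: "'w measure" and f
  assume \<eta>: "0 < \<eta>" "\<eta> \<le> 1/4 * (\<nu>2 - \<nu>1)\<^sup>2"
    and f: "random_polynomial n D \<Omega> f" and opt: "optimizes n e d \<Omega> f k \<delta> \<gamma> \<eta>"
  have n: "0 < n" using d by (cases n) auto
  define p where "p = d / n"
  have p: "0 < p" "p \<le> 1 / 2" "p < 1" using d n by (auto simp: p_def field_simps)
  define \<epsilon> where "\<epsilon> = \<nu>2 - \<nu>1"
  \<comment> \<open>With this threshold \<open>4 * D * (3 * (\<gamma> * k)) / T\<close> has the
    constant \<open>96\<close> of the hypothesis, while \<open>\<eta> * n + 4 * T\<close> stays at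
    most \<open>3/4 * \<epsilon>\<^sup>2 * n\<close>.\<close>
  define T where "T = \<epsilon>\<^sup>2 * n / 8"
  have \<epsilon>: "0 < \<epsilon>" using nu by (simp add: \<epsilon>_def)
  have T: "0 < T" using \<epsilon> n by (simp add: T_def)
  define X where "X = exp (4 * real D * (3 * (\<gamma> * k)) / T * ln p)"
  define P where "P = measure_pmf.prob (pair_pmf (biased p {1..m}) (biased p {1..m}))"
  have gnp: "gnp n (d / real n) = biased p {1..m}" by (simp add: gnp_def p_def m)
  define OG where "OG = {(Y, Y'). overlap_gap n (path_family n e Y Y') (real k) \<nu>1 \<nu>2 \<and>
                  separated_above n (objective n e Y) (objective n e Y') \<nu>1 (real k)}"
  have X_eq: "X = exp (- ((96 * \<gamma> * real D * real k * ln (real n / d)) / ((\<nu>2 - \<nu>1)\<^sup>2 * real n)))"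
    unfolding X_def
  proof (rule arg_cong[where f = exp])
    have "ln p = - ln (n / d)" using d n by (simp add: p_def ln_div)
    then show "4 * real D * (3 * (\<gamma> * k)) / T * ln p =
       - ((96 * \<gamma> * real D * real k * ln (real n / d)) / ((\<nu>2 - \<nu>1)\<^sup>2 * real n))"
      using \<epsilon> n by (simp add: T_def \<epsilon>_def field_simps)
  qed
  have X_le: "X \<le> 1"
    unfolding X_def exp_le_one_iff using p T gamma
    by (intro mult_nonneg_nonpos divide_nonneg_pos mult_nonneg_nonneg) auto
  have OG: "1 - \<Delta> \<le> P OG" using ogp by (simp add: P_def OG_def gnp)
  then have "0 \<le> \<Delta>"
    using measure_pmf.prob_le_1[of "pair_pmf (biased p {1..m}) (biased p {1..m})" OG]
    unfolding P_def by linarith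
  have "3 * \<delta> * (real m + 1) \<ge> 0" using delta by simp
  have small': "\<Delta> + 3 * \<delta> * (real m + 1) < X" using small X_eq by simp
  have "\<Delta> < 1" "3 * \<delta> * (real m + 1) < 1"
    using small' X_le \<open>0 \<le> \<Delta>\<close> \<open>3 * \<delta> * (real m + 1) \<ge> 0\<close> by linarith+
  moreover have "\<delta> \<le> 3 * \<delta> * (real m + 1)"
    using delta by (simp add: algebra_simps)
  ultimately have "\<delta> < 1" by linarith
  \<comment> \<open>For \<open>k = 0\<close> the empty sets, with overlap \<open>0\<close>, would
    violate separation, as \<open>\<nu>1 < \<nu>2 \<le> 0\<close>. Positivity enters the choice of
    the seed and makes the rounded sets nonempty.\<close>
  have "0 < k"
  proof (rule ccontr)
    assume "\<not> 0 < k"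
    then have "\<nu>1 < 0" "k = 0" using nu n by (auto simp: mult_le_0_iff)
    have "P OG \<noteq> 0" using OG \<open>\<Delta> < 1\<close> by linarith
    then have "OG \<noteq> {}" by (auto simp: P_def)
    then obtain Y Y' where "separated_above n (objective n e Y) (objective n e Y') \<nu>1 0"
      using \<open>k = 0\<close> by (auto simp: OG_def)
    then have "overlap n (ind_vec {}) (ind_vec {}) \<le> \<nu>1"
      using objective_ind_vec[of "{}" n e Y] objective_ind_vec[of "{}" n e Y'] ind_vec_cube[of "{}" n]
      by (simp add: separated_above_def indep_sets_of_def)
    then show False using \<open>\<nu>1 < 0\<close> by (simp add: overlap_ind_vec)
  qed
  \<comment> \<open>Raising \<open>\<delta>\<close> to \<open>\<delta>'\<close> spends half of the
    slack in the hypothesis, so the strict inequality survives.\<close>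
  define \<delta>' where "\<delta>' = \<delta> + (X - (\<Delta> + 3 * \<delta> * (real m + 1))) / (6 * (real m + 1))"
  have \<delta>': "\<delta> < \<delta>'" "0 < \<delta>'"
    using small' delta by (auto simp: \<delta>'_def intro!: add_nonneg_pos)
  have small'': "\<Delta> + 3 * \<delta>' * (real m + 1) < X"
  proof -
    have "3 * \<delta>' * (real m + 1) = 3 * \<delta> * (real m + 1) + (X - (\<Delta> + 3 * \<delta> * (real m + 1))) / 2"
      unfolding \<delta>'_def by (simp add: field_simps)
    moreover have "\<Delta> + b < X" if "b = a + (X - (\<Delta> + a)) / 2" "\<Delta> + a < X" for a b
      using that by (simp add: field_simps)
    ultimately show ?thesis using small' by blast
  qed
  obtain \<omega> where \<omega>: "\<omega> \<in> space \<Omega>"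
    and mom: "measure_pmf.expectation (gnp n (d / real n))
           (\<lambda>Y. indicator (cube (n choose 2)) Y * (\<Sum>i=1..n. (f Y \<omega> i)\<^sup>2)) \<le> 3 * (\<gamma> * real k)"
    and succ: "measure_pmf.prob (gnp n (d / real n))
           {Y \<in> cube (n choose 2). k \<le> card (rounded n e \<eta> f Y \<omega>)} \<ge> 1 - 3 * \<delta>'"
    using exists_good_seed[OF f opt \<open>\<delta> < 1\<close> \<delta>'] gamma \<open>0 < k\<close> by auto
  have "\<exists>c. (\<forall>S. D < card S \<longrightarrow> c S = 0) \<and> (\<forall>Y\<in>cube m. f Y \<omega> i = multilin c {1..m} Y)"
    if "i \<in> {1..n}" for i
  proof -
    from f \<omega> that obtain q where "q \<in> mpolys_deg_le m D" "\<forall>Y\<in>cube m. f Y \<omega> i = eval_mpoly q Y"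
      unfolding random_polynomial_def m by blast
    then show ?thesis by (metis eval_mpoly_cube_eq_multilin)
  qed
  then obtain c where c: "\<And>i S. i \<in> {1..n} \<Longrightarrow> D < card S \<Longrightarrow> c i S = 0"
    "\<And>i Y. i \<in> {1..n} \<Longrightarrow> Y \<in> cube m \<Longrightarrow> f Y \<omega> i = multilin (c i) {1..m} Y"
    by metis
  have mean_f: "mean p {1..m} (\<lambda>Y. \<Sum>i=1..n. (f Y \<omega> i)\<^sup>2) \<le> 3 * (\<gamma> * real k)"
  proof -
    have "mean p {1..m} (\<lambda>Y. \<Sum>i=1..n. (f Y \<omega> i)\<^sup>2) =
        mean p {1..m} (\<lambda>Y. indicator (cube m) Y * (\<Sum>i=1..n. (f Y \<omega> i)\<^sup>2))"
      by (intro mean_cong) (auto simp: cube_eq)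
    then show ?thesis using mom by (simp add: gnp m)
  qed

  \<comment> \<open>Events on the random path\<close>
  define ST where "ST = {(Y, Y'). \<forall>j\<in>{1..m}.
    (\<Sum>i=1..n. (f (path_vertex (j - 1) Y Y') \<omega> i - f (path_vertex j Y Y') \<omega> i)\<^sup>2) \<le> T}"
  have ST: "X \<le> P ST"
    unfolding X_def P_def ST_def
    using no_large_step_prob_ge[OF p(1,2) _ T c mean_f] by simp
  define A where "A = {Y \<in> cube m. k \<le> card (rounded n e \<eta> f Y \<omega>)}"
  define Z where "Z i = {(Y, Y'). path_vertex i Y Y' \<in> A}" for i
  have P_compl: "P (- S) = 1 - P S" for S
    unfolding P_def Compl_eq_Diff_UNIV using measure_pmf.prob_compl[of S] by simp
  have Z: "P (- Z i) \<le> 3 * \<delta>'" if "i \<le> m" for i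
  proof -
    have "P (Z i) = measure_pmf.prob (biased p {1..m}) A"
      unfolding P_def Z_def by (rule prob_path_vertex[OF p(1,3) that])
    also have "\<dots> \<ge> 1 - 3 * \<delta>'" using succ unfolding A_def gnp m .
    finally show ?thesis unfolding P_compl by linarith
  qed
  \<comment> \<open>For vectors outside the cube the path need not start at \<open>Y\<close> or end
    at \<open>Y'\<close>, so the pair has to be picked inside.\<close>
  define C where "C = {(Y, Y'). Y \<in> cube m \<and> Y' \<in> cube m}"
  have "P (- C) = 0"
    unfolding P_def measure_pmf_zero_iff C_def using set_biased_cube by auto
  \<comment> \<open>Union bound: the complement of \<open>OG\<close> costs \<open>\<Delta>\<close>,
    and each of the \<open>m + 1\<close> path vertices, distributed like \<open>G(n, d/n)\<close>,
    costs \<open>3 * \<delta>'\<close>. The total is below \<open>X\<close>, the lower bound for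
    \<open>ST\<close>.\<close>
  have "ST \<inter> OG \<inter> C \<inter> (\<Inter>i\<in>{..m}. Z i) \<noteq> {}"
  proof
    assume "ST \<inter> OG \<inter> C \<inter> (\<Inter>i\<in>{..m}. Z i) = {}"
    then have "ST \<subseteq> (- OG \<union> - C) \<union> (\<Union>i\<in>{..m}. - Z i)" by blast
    then have "P ST \<le> P ((- OG \<union> - C) \<union> (\<Union>i\<in>{..m}. - Z i))"
      unfolding P_def by (intro measure_pmf.finite_measure_mono) auto
    also have "\<dots> \<le> P (- OG \<union> - C) + P (\<Union>i\<in>{..m}. - Z i)"
      unfolding P_def by (intro measure_Un_le) auto
    also have "P (- OG \<union> - C) \<le> P (- OG) + P (- C)"
      unfolding P_def by (intro measure_Un_le) auto
    also have "P (- OG) = 1 - P OG"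
      by (rule P_compl)
    also have "P (\<Union>i\<in>{..m}. - Z i) \<le> (\<Sum>i\<in>{..m}. P (- Z i))"
      unfolding P_def by (intro measure_UNION_le) auto
    also have "\<dots> \<le> (\<Sum>i\<in>{..m}. 3 * \<delta>')"
      by (intro sum_mono Z) auto
    finally have "P ST \<le> \<Delta> + 3 * \<delta>' * (real m + 1)"
      using OG \<open>P (- C) = 0\<close> by (simp add: algebra_simps)
    with ST small'' show False by linarith
  qed
  then obtain Y Y' where YY: "(Y, Y') \<in> ST" "(Y, Y') \<in> OG" "Y \<in> cube m" "Y' \<in> cube m"
    and Zi: "\<And>i. i \<le> m \<Longrightarrow> path_vertex i Y Y' \<in> A"
    by (auto simp: C_def Z_def)
  define V where "V i = rounded n e \<eta> f (path_vertex i Y Y') \<omega>" for i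
  have V: "k \<le> card (V i)" if "i \<le> m" for i
    using Zi[OF that] by (simp add: A_def V_def)
  obtain i where i: "i < m" "\<epsilon> * n \<le> card (V i - V (Suc i))" "0 \<le> \<nu>1"
    using overlap_gap_jump[OF n, of Y Y' \<nu>1 \<nu>2 k e V] YY nu V
    by (auto simp: OG_def m \<epsilon>_def V_def rounded_indep)
  have "V (Suc i) \<noteq> {}" using V[of "Suc i"] i(1) \<open>0 < k\<close> by auto
  then have "card (V i - V (Suc i)) \<le> \<eta> * n +
      4 * (\<Sum>l=1..n. (f (path_vertex i Y Y') \<omega> l - f (path_vertex (Suc i) Y Y') \<omega> l)\<^sup>2)"
    unfolding V_def by (rule card_rounded_diff_le)
  also have "\<dots> \<le> (1/4 * \<epsilon>\<^sup>2) * n + 4 * T"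
    using \<eta>(2) YY(1) i(1) by (intro add_mono mult_left_mono mult_right_mono)
      (auto simp: \<epsilon>_def ST_def dest: bspec[of _ _ "Suc i"])
  finally have "\<epsilon> * n \<le> 3/4 * \<epsilon>\<^sup>2 * n"
    using i(2) by (simp add: T_def algebra_simps)
  \<comment> \<open>The jump forces \<open>\<epsilon> \<ge> 4/3\<close>, whereas
    \<open>0 \<le> \<nu>1\<close> and \<open>\<nu>2 \<le> 1\<close> give
    \<open>\<epsilon> \<le> 1\<close>.\<close>
  then have "1 \<le> 3/4 * \<epsilon>"
    using n \<epsilon> by (simp add: power2_eq_square)
  moreover have "\<nu>2 \<le> 1"
  proof -
    have "card (V 0) \<le> card {1..n}"
      using rounded_indep[of n e \<eta> f "path_vertex 0 Y Y'" \<omega>]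
      by (intro card_mono) (auto simp: V_def indep_sets_of_def)
    then have "\<nu>2 * n \<le> 1 * n" using nu(2) V[of 0] by simp
    then show ?thesis using n by simp
  qed
  ultimately show False using i(3) by (simp add: \<epsilon>_def)
qed

end
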